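(* Let $R$ be a ring satisfying the $\alpha$-condition for an endomorphism $\alpha$ of $R$. If $R$ is $\alpha$-skew Armendariz, then $R$ is LNZS if and only if the skew polynomial ring $R[x;\alpha]$ is LNZS.
   Context: All rings are associative with identity. $N(R)$ is the set of nilpotent elements of $R$; for $a\in R$, $l(a)=\{y\in R: ya=0\}$. A ring $R$ is LNZS (left nil zero semicommutative) if $l(a)$ is a two-sided ideal of $R$ for every $a\in N(R)$. For an endomorphism $\alpha$ of $R$, $R[x;\alpha]$ denotes the skew polynomial ring, whose elements are polynomials $\sum_{i=0}^n w_ix^i$ with $w_i\in R$, with the usual addition and with multiplication determined by $xw=\alpha(w)x$ for $w\in R$. $R$ satisfies the $\alpha$-condition if for all $a,b\in R$: $ab=0$ if and only if $a\alpha(b)=0$. $R$ is $\alpha$-skew Armendariz if whenever $f(x)=\sum_{i=0}^n w_ix^i$ and $g(x)=\sum_{j=0}^m h_jx^j$ in $R[x;\alpha]$ satisfy $f(x)g(x)=0$, then $w_i\alpha^i(h_j)=0$ for all $i$ and $j$. *)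

theory Defs
  imports "HOL-Algebra.UnivPoly"
begin

definition nilpotents :: "('a, 'm) ring_scheme \<Rightarrow> 'a set"
  where "nilpotents R = {a \<in> carrier R. \<exists>n::nat. n \<ge> 1 \<and> a [^]\<^bsub>R\<^esub> n = \<zero>\<^bsub>R\<^esub>}"

definition left_ann :: "('a, 'm) ring_scheme \<Rightarrow> 'a \<Rightarrow> 'a set"
  where "left_ann R a = {y \<in> carrier R. y \<otimes>\<^bsub>R\<^esub> a = \<zero>\<^bsub>R\<^esub>}"

definition LNZS :: "('a, 'm) ring_scheme \<Rightarrow> bool"
  where "LNZS R \<longleftrightarrow> (\<forall>a\<in>nilpotents R. ideal (left_ann R a) R)"

text \<open>
  The skew polynomial ring has the same additive group as the ordinary polynomial ring; only
  the multiplication is twisted.  Expanding \<open>(w x\<^sup>i) (h x\<^sup>j)\<close> with \<open>x w = \<alpha>(w) x\<close> gives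
  \<open>w \<alpha>\<^sup>i(h) x\<^sup>i\<^sup>+\<^sup>j\<close>.
\<close>

definition skew_UP :: "('a, 'm) ring_scheme \<Rightarrow> ('a \<Rightarrow> 'a) \<Rightarrow> ('a, nat \<Rightarrow> 'a) up_ring"
  where "skew_UP R \<alpha> = (UP R)
    \<lparr>mult := (\<lambda>p\<in>up R. \<lambda>q\<in>up R. \<lambda>n. \<Oplus>\<^bsub>R\<^esub>i \<in> {..n}. p i \<otimes>\<^bsub>R\<^esub> (\<alpha> ^^ i) (q (n - i)))\<rparr>"

definition alpha_condition :: "('a, 'm) ring_scheme \<Rightarrow> ('a \<Rightarrow> 'a) \<Rightarrow> bool"
  where "alpha_condition R \<alpha> \<longleftrightarrow>
    (\<forall>a\<in>carrier R. \<forall>b\<in>carrier R. a \<otimes>\<^bsub>R\<^esub> b = \<zero>\<^bsub>R\<^esub> \<longleftrightarrow> a \<otimes>\<^bsub>R\<^esub> \<alpha> b = \<zero>\<^bsub>R\<^esub>)"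

definition skew_Armendariz :: "('a, 'm) ring_scheme \<Rightarrow> ('a \<Rightarrow> 'a) \<Rightarrow> bool"
  where "skew_Armendariz R \<alpha> \<longleftrightarrow>
    (\<forall>f\<in>carrier (skew_UP R \<alpha>). \<forall>g\<in>carrier (skew_UP R \<alpha>).
       f \<otimes>\<^bsub>skew_UP R \<alpha>\<^esub> g = \<zero>\<^bsub>skew_UP R \<alpha>\<^esub> \<longrightarrow>
       (\<forall>i j. coeff (skew_UP R \<alpha>) f i \<otimes>\<^bsub>R\<^esub> (\<alpha> ^^ i) (coeff (skew_UP R \<alpha>) g j) = \<zero>\<^bsub>R\<^esub>))"

text \<open>
  The twisted multiplication makes \<^const>\<open>skew_UP\<close> a ring in which \<open>x w = \<alpha>(w) x\<close>.
\<close>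

lemma carrier_skew_UP: "carrier (skew_UP R \<alpha>) = up R"
  by (simp add: skew_UP_def UP_def)

lemma skew_UP_ops:
  "add (skew_UP R \<alpha>) = add (UP R)"
  "\<zero>\<^bsub>skew_UP R \<alpha>\<^esub> = \<zero>\<^bsub>UP R\<^esub>"
  "\<one>\<^bsub>skew_UP R \<alpha>\<^esub> = \<one>\<^bsub>UP R\<^esub>"
  by (simp_all add: skew_UP_def)

lemma skew_UP_mult:
  "\<lbrakk>p \<in> up R; q \<in> up R\<rbrakk> \<Longrightarrow>
   p \<otimes>\<^bsub>skew_UP R \<alpha>\<^esub> q = (\<lambda>n. \<Oplus>\<^bsub>R\<^esub>i \<in> {..n}. p i \<otimes>\<^bsub>R\<^esub> (\<alpha> ^^ i) (q (n - i)))"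
  by (simp add: skew_UP_def)

context ring
begin

lemma funpow_ring_hom:
  assumes "\<alpha> \<in> ring_hom R R" shows "\<alpha> ^^ n \<in> ring_hom R R"
proof (induction n)
  case 0
  then show ?case by (simp add: ring_hom_def)
next
  case (Suc n)
  show ?case using ring_hom_trans[OF Suc assms] by (simp only: funpow.simps)
qed

lemma finsum_triangle:
  assumes "\<And>i j. F i j \<in> carrier R"
  shows "(\<Oplus>j \<in> {..n::nat}. \<Oplus>i \<in> {..j}. F i (j - i)) = (\<Oplus>i \<in> {..n}. \<Oplus>j \<in> {..n - i}. F i j)"
proof (induction n)
  case 0
  then show ?case using assms by simp
next
  case (Suc n)
  have "(\<Oplus>i \<in> {..n}. \<Oplus>j \<in> {..Suc n - i}. F i j)
      = (\<Oplus>i \<in> {..n}. F i (Suc n - i) \<oplus> (\<Oplus>j \<in> {..n - i}. F i j))"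
    using assms by (intro finsum_cong') (auto simp: Suc_diff_le)
  also have "\<dots> = (\<Oplus>i \<in> {..n}. F i (Suc n - i)) \<oplus> (\<Oplus>i \<in> {..n}. \<Oplus>j \<in> {..n - i}. F i j)"
    using assms by (intro finsum_addf) auto
  finally show ?case
    using assms Suc by (simp add: a_assoc Pi_def)
qed

lemma skew_UP_mult_closed:
  assumes h: "\<alpha> \<in> ring_hom R R" and p: "p \<in> up R" and q: "q \<in> up R"
  shows "(\<lambda>n. \<Oplus>i \<in> {..n}. p i \<otimes> (\<alpha> ^^ i) (q (n - i))) \<in> up R"
proof
  note H = funpow_ring_hom[OF h]
  show "(\<Oplus>i \<in> {..n}. p i \<otimes> (\<alpha> ^^ i) (q (n - i))) \<in> carrier R" for n
    by (intro finsum_closed funcsetI m_closed ring_hom_closed[OF H] mem_upD[OF p] mem_upD[OF q])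
  from p obtain n where n: "bound \<zero> n p" by auto
  from q obtain m where m: "bound \<zero> m q" by auto
  have "bound \<zero> (n + m) (\<lambda>n. \<Oplus>i \<in> {..n}. p i \<otimes> (\<alpha> ^^ i) (q (n - i)))"
  proof
    fix k assume k: "n + m < k"
    have "p i \<otimes> (\<alpha> ^^ i) (q (k - i)) = \<zero>" for i
    proof (cases "n < i")
      case True
      with n have "p i = \<zero>" by auto
      then show ?thesis using ring_hom_closed[OF H mem_upD[OF q]] by simp
    next
      case False
      with k have "m < k - i" by arith
      with m have "q (k - i) = \<zero>" by auto
      then show ?thesis using ring_hom_zero[OF H ring_axioms ring_axioms] mem_upD[OF p] by simp
    qed
    then show "(\<Oplus>i \<in> {..k}. p i \<otimes> (\<alpha> ^^ i) (q (k - i))) = \<zero>" by simp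
  qed
  then show "\<exists>n. bound \<zero> n (\<lambda>n. \<Oplus>i \<in> {..n}. p i \<otimes> (\<alpha> ^^ i) (q (n - i)))" ..
qed

lemma hom_finsum_endo:
  assumes h: "f \<in> ring_hom R R" and "\<And>i. g i \<in> carrier R"
  shows "f (\<Oplus>i \<in> {..n::nat}. g i) = (\<Oplus>i \<in> {..n}. f (g i))"
proof (induction n)
  case 0 then show ?case using assms ring_hom_closed[OF h] by simp
next
  case (Suc n) then show ?case using assms ring_hom_closed[OF h] by (simp add: ring_hom_add[OF h] Pi_def)
qed

lemma skew_UP_assoc:
  assumes h: "\<alpha> \<in> ring_hom R R" and P: "p \<in> up R" "q \<in> up R" "r \<in> up R"
  shows "(\<Oplus>j \<in> {..n}. (\<Oplus>i \<in> {..j}. p i \<otimes> (\<alpha> ^^ i) (q (j - i))) \<otimes> (\<alpha> ^^ j) (r (n - j)))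
    = (\<Oplus>i \<in> {..n}. p i \<otimes> (\<alpha> ^^ i) (\<Oplus>j \<in> {..n - i}. q j \<otimes> (\<alpha> ^^ j) (r (n - i - j))))"
proof -
  note H = funpow_ring_hom[OF h]
  have c [simp]: "p i \<in> carrier R" "q i \<in> carrier R" "r i \<in> carrier R" for i using P by auto
  have hc [simp]: "x \<in> carrier R \<Longrightarrow> (\<alpha> ^^ i) x \<in> carrier R" for i x using ring_hom_closed[OF H] .
  define F where "F = (\<lambda>i j. p i \<otimes> (\<alpha> ^^ i) (q j) \<otimes> (\<alpha> ^^ (i + j)) (r (n - i - j)))"
  have Fc: "F i j \<in> carrier R" for i j by (simp add: F_def)
  have "(\<Oplus>i \<in> {..j}. p i \<otimes> (\<alpha> ^^ i) (q (j - i))) \<otimes> (\<alpha> ^^ j) (r (n - j)) = (\<Oplus>i \<in> {..j}. F i (j - i))" for j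
    by (subst finsum_ldistr) (auto intro!: finsum_cong' simp: F_def)
  moreover have "p i \<otimes> (\<alpha> ^^ i) (\<Oplus>j \<in> {..n - i}. q j \<otimes> (\<alpha> ^^ j) (r (n - i - j))) = (\<Oplus>j \<in> {..n - i}. F i j)" for i
    by (subst hom_finsum_endo[OF H], simp, subst finsum_rdistr)
      (auto intro!: finsum_cong' simp: F_def ring_hom_mult[OF H] m_assoc funpow_add)
  ultimately show ?thesis using finsum_triangle[of F n, OF Fc] by simp
qed

theorem skew_UP_ring:
  assumes h: "\<alpha> \<in> ring_hom R R"
  shows "ring (skew_UP R \<alpha>)"
proof -
  interpret U: UP_ring R "UP R" by unfold_locales simp_all
  note H = funpow_ring_hom[OF h]
  have hc: "x \<in> carrier R \<Longrightarrow> (\<alpha> ^^ i) x \<in> carrier R" for i x using ring_hom_closed[OF H] .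
  have h0: "(\<alpha> ^^ i) \<zero> = \<zero>" for i using ring_hom_zero[OF H ring_axioms ring_axioms] .
  have cUP: "carrier (UP R) = up R" by (simp add: UP_def)
  have C: "carrier (skew_UP R \<alpha>) = carrier (UP R)" by (simp add: carrier_skew_UP cUP)
  have add: "p \<oplus>\<^bsub>UP R\<^esub> q = (\<lambda>i. p i \<oplus> q i)" if "p \<in> up R" "q \<in> up R" for p q
    using that by (simp add: UP_def)
  have one: "\<one>\<^bsub>UP R\<^esub> = (\<lambda>i. if i = 0 then \<one> else \<zero>)" by (simp add: UP_def)
  show ?thesis
  proof (rule ringI)
    show "abelian_group (skew_UP R \<alpha>)"
    proof (rule abelian_groupI)
      fix x assume "x \<in> carrier (skew_UP R \<alpha>)"
      then show "\<exists>y\<in>carrier (skew_UP R \<alpha>). y \<oplus>\<^bsub>skew_UP R \<alpha>\<^esub> x = \<zero>\<^bsub>skew_UP R \<alpha>\<^esub>"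
        using U.UP_l_neg_ex by (simp add: C skew_UP_ops)
    qed (simp_all only: C skew_UP_ops U.UP_a_closed U.UP_zero_closed U.UP_l_zero U.UP_a_assoc, rule U.UP_a_comm)
    show "monoid (skew_UP R \<alpha>)"
    proof (rule monoidI)
      fix p q r assume "p \<in> carrier (skew_UP R \<alpha>)" "q \<in> carrier (skew_UP R \<alpha>)" "r \<in> carrier (skew_UP R \<alpha>)"
      then show "p \<otimes>\<^bsub>skew_UP R \<alpha>\<^esub> q \<otimes>\<^bsub>skew_UP R \<alpha>\<^esub> r = p \<otimes>\<^bsub>skew_UP R \<alpha>\<^esub> (q \<otimes>\<^bsub>skew_UP R \<alpha>\<^esub> r)"
        by (simp add: carrier_skew_UP skew_UP_mult skew_UP_mult_closed[OF h] skew_UP_assoc[OF h])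
    next
      fix p assume p: "p \<in> carrier (skew_UP R \<alpha>)"
      then have pc: "p i \<in> carrier R" for i by (auto simp: carrier_skew_UP)
      have "(\<Oplus>i \<in> {..n}. \<one>\<^bsub>UP R\<^esub> i \<otimes> (\<alpha> ^^ i) (p (n - i))) = p n" for n
      proof -
        have "(\<Oplus>i \<in> {..n}. \<one>\<^bsub>UP R\<^esub> i \<otimes> (\<alpha> ^^ i) (p (n - i))) = (\<Oplus>i \<in> {..n}. if 0 = i then p (n - i) else \<zero>)"
          by (intro finsum_cong') (auto simp: one pc hc)
        also have "\<dots> = p n" using finsum_singleton[of 0 "{..n}" "\<lambda>i. p (n - i)"] pc by simp
        finally show ?thesis .
      qed
      then show "\<one>\<^bsub>skew_UP R \<alpha>\<^esub> \<otimes>\<^bsub>skew_UP R \<alpha>\<^esub> p = p"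
        using p U.UP_one_closed by (simp add: carrier_skew_UP skew_UP_ops skew_UP_mult cUP)
      have "(\<Oplus>i \<in> {..n}. p i \<otimes> (\<alpha> ^^ i) (\<one>\<^bsub>UP R\<^esub> (n - i))) = p n" for n
      proof -
        have "(\<Oplus>i \<in> {..n}. p i \<otimes> (\<alpha> ^^ i) (\<one>\<^bsub>UP R\<^esub> (n - i))) = (\<Oplus>i \<in> {..n}. if n = i then p i else \<zero>)"
          by (intro finsum_cong') (auto simp: one pc h0 ring_hom_one[OF H])
        also have "\<dots> = p n" using finsum_singleton[of n "{..n}" p] pc by simp
        finally show ?thesis .
      qed
      then show "p \<otimes>\<^bsub>skew_UP R \<alpha>\<^esub> \<one>\<^bsub>skew_UP R \<alpha>\<^esub> = p"
        using p U.UP_one_closed by (simp add: carrier_skew_UP skew_UP_ops skew_UP_mult cUP)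
    qed (use U.UP_one_closed in \<open>simp_all add: carrier_skew_UP skew_UP_ops skew_UP_mult skew_UP_mult_closed[OF h] cUP\<close>)
  next
    fix p q r assume "p \<in> carrier (skew_UP R \<alpha>)" "q \<in> carrier (skew_UP R \<alpha>)" "r \<in> carrier (skew_UP R \<alpha>)"
    then have P: "p \<in> up R" "q \<in> up R" "r \<in> up R" by (simp_all add: carrier_skew_UP)
    then have c: "p i \<in> carrier R" "q i \<in> carrier R" "r i \<in> carrier R" for i by auto
    show "(p \<oplus>\<^bsub>skew_UP R \<alpha>\<^esub> q) \<otimes>\<^bsub>skew_UP R \<alpha>\<^esub> r = p \<otimes>\<^bsub>skew_UP R \<alpha>\<^esub> r \<oplus>\<^bsub>skew_UP R \<alpha>\<^esub> q \<otimes>\<^bsub>skew_UP R \<alpha>\<^esub> r"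
      by (simp add: P c hc skew_UP_ops skew_UP_mult skew_UP_mult_closed[OF h] add up_add_closed l_distr
          Pi_def)
    show "r \<otimes>\<^bsub>skew_UP R \<alpha>\<^esub> (p \<oplus>\<^bsub>skew_UP R \<alpha>\<^esub> q) = r \<otimes>\<^bsub>skew_UP R \<alpha>\<^esub> p \<oplus>\<^bsub>skew_UP R \<alpha>\<^esub> r \<otimes>\<^bsub>skew_UP R \<alpha>\<^esub> q"
      by (simp add: P c hc skew_UP_ops skew_UP_mult skew_UP_mult_closed[OF h] add up_add_closed
          ring_hom_add[OF H] r_distr Pi_def)
  qed
qed

theorem skew_UP_commute:
  fixes \<alpha>
  defines "P \<equiv> skew_UP R \<alpha>"
  assumes h: "\<alpha> \<in> ring_hom R R" and w: "w \<in> carrier R"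
  shows "monom P \<one> 1 \<otimes>\<^bsub>P\<^esub> monom P w 0 = monom P (\<alpha> w) 0 \<otimes>\<^bsub>P\<^esub> monom P \<one> 1"
proof -
  interpret U: UP_ring R "UP R" by unfold_locales simp_all
  note H = funpow_ring_hom[OF h]
  have aw: "\<alpha> w \<in> carrier R" using ring_hom_closed[OF h w] .
  have h0: "(\<alpha> ^^ i) \<zero> = \<zero>" for i using ring_hom_zero[OF H ring_axioms ring_axioms] .
  have m: "monom P = monom (UP R)" by (simp add: P_def skew_UP_def)
  have mv: "monom (UP R) a k = (\<lambda>i. if i = k then a else \<zero>)" if "a \<in> carrier R" for a k
    using that by (simp add: UP_def)
  have mc: "monom (UP R) a k \<in> up R" if "a \<in> carrier R" for a k
    using U.monom_closed[OF that, of k] by (simp add: UP_def)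
  have l: "(\<Oplus>i \<in> {..n}. monom (UP R) \<one> 1 i \<otimes> (\<alpha> ^^ i) (monom (UP R) w 0 (n - i)))
      = (if n = 1 then \<alpha> w else \<zero>)" for n
  proof -
    have "(\<Oplus>i \<in> {..n}. monom (UP R) \<one> 1 i \<otimes> (\<alpha> ^^ i) (monom (UP R) w 0 (n - i)))
      = (\<Oplus>i \<in> {..n}. if n = i then (if i = 1 then \<alpha> w else \<zero>) else \<zero>)"
      by (intro finsum_cong') (auto simp: mv w aw h0 ring_hom_closed[OF H])
    also have "\<dots> = (if n = 1 then \<alpha> w else \<zero>)"
      using finsum_singleton[of n "{..n}" "\<lambda>i. if i = 1 then \<alpha> w else \<zero>"] aw by simp
    finally show ?thesis .
  qed
  have r: "(\<Oplus>i \<in> {..n}. monom (UP R) (\<alpha> w) 0 i \<otimes> (\<alpha> ^^ i) (monom (UP R) \<one> 1 (n - i)))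
      = (if n = 1 then \<alpha> w else \<zero>)" for n
  proof -
    have "(\<Oplus>i \<in> {..n}. monom (UP R) (\<alpha> w) 0 i \<otimes> (\<alpha> ^^ i) (monom (UP R) \<one> 1 (n - i)))
      = (\<Oplus>i \<in> {..n}. if 0 = i then (if n - i = 1 then \<alpha> w else \<zero>) else \<zero>)"
      by (intro finsum_cong') (auto simp: mv w aw h0 ring_hom_closed[OF H])
    also have "\<dots> = (if n = 1 then \<alpha> w else \<zero>)"
      using finsum_singleton[of 0 "{..n}" "\<lambda>i. if n - i = 1 then \<alpha> w else \<zero>"] aw by simp
    finally show ?thesis .
  qed
  show ?thesis unfolding m unfolding P_def
    by (simp only: skew_UP_mult[OF mc mc] w aw one_closed l r)
qed

end

end

(* Under the alpha-condition and the Armendariz property, f g = 0 holds in R[x;alpha] exactly when every coefficient of f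
   left annihilates every coefficient of g. Peeling off one factor at a time shows that the coefficients of
   a nilpotent f are nilpotent, so if g f = 0 then the coefficients of g stay in the left annihilators of
   the coefficients of f after right multiplication. For the converse, R embeds as the constant polynomials. *)
theory Submission
  imports Defs
begin

context ring
begin

text \<open>The set \<open>left_ann R a\<close> is always a left ideal, so two-sidedness comes down
  to stability under right multiplication. This elementwise form serves both for \<open>R\<close>
  and for the skew polynomial ring.\<close>

lemma LNZS_iff:
  "LNZS R \<longleftrightarrow> (\<forall>a\<in>nilpotents R. \<forall>y\<in>carrier R. \<forall>r\<in>carrier R.
     y \<otimes> a = \<zero> \<longrightarrow> y \<otimes> r \<otimes> a = \<zero>)"
proof -
  have "ideal (left_ann R a) R \<longleftrightarrow>
      (\<forall>y\<in>carrier R. \<forall>r\<in>carrier R. y \<otimes> a = \<zero> \<longrightarrow> y \<otimes> r \<otimes> a = \<zero>)"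
    (is "_ \<longleftrightarrow> ?stable") if a: "a \<in> carrier R" for a
  proof
    assume "ideal (left_ann R a) R"
    then show ?stable
      using ideal.I_r_closed[of "left_ann R a" R] by (auto simp: left_ann_def)
  next
    assume stable: ?stable
    show "ideal (left_ann R a) R"
    proof (rule idealI)
      show "subgroup (left_ann R a) (add_monoid R)"
      proof (rule add.subgroupI)
        show "\<ominus> y \<in> left_ann R a" if "y \<in> left_ann R a" for y
          using that a l_minus by (auto simp: left_ann_def)
      qed (use a l_distr in \<open>auto simp: left_ann_def\<close>)
    qed (use a stable in \<open>auto simp: left_ann_def m_assoc ring_axioms\<close>)
  qed
  then show ?thesis
    by (auto simp: LNZS_def nilpotents_def)
qed

text \<open>Iterating the condition lets the twist by \<alpha>^i, which skew multiplication puts on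
  the right factor, be removed or inserted in any vanishing product.\<close>

lemma alpha_condition_funpow:
  assumes h: "\<alpha> \<in> ring_hom R R" and cond: "alpha_condition R \<alpha>"
    and a: "a \<in> carrier R" and b: "b \<in> carrier R"
  shows "a \<otimes> (\<alpha> ^^ n) b = \<zero> \<longleftrightarrow> a \<otimes> b = \<zero>"
proof (induction n)
  case (Suc n)
  have "(\<alpha> ^^ n) b \<in> carrier R"
    using ring_hom_closed[OF funpow_ring_hom[OF h] b] .
  then show ?case
    using Suc cond a by (simp add: alpha_condition_def)
qed simp

text \<open>Forwards, the Armendariz property kills each twisted product and the twist is then
  removed. Backwards, the twist is put back and every summand of every coefficient vanishes. As the
  right side pairs all coefficients independently, single coefficients can be exchanged for constant
  polynomials.\<close>

lemma skew_UP_mult_eq_zero_iff: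
  assumes h: "\<alpha> \<in> ring_hom R R" and cond: "alpha_condition R \<alpha>"
    and arm: "skew_Armendariz R \<alpha>" and p: "p \<in> up R" and q: "q \<in> up R"
  shows "p \<otimes>\<^bsub>skew_UP R \<alpha>\<^esub> q = \<zero>\<^bsub>skew_UP R \<alpha>\<^esub> \<longleftrightarrow> (\<forall>i j. p i \<otimes> q j = \<zero>)"
    (is "?prod \<longleftrightarrow> ?coeffs")
proof
  have c: "p i \<in> carrier R" "q i \<in> carrier R" for i
    using p q by auto
  note swap = alpha_condition_funpow[OF h cond c]
  show ?coeffs if ?prod
  proof (intro allI)
    fix i j
    have "p i \<otimes> (\<alpha> ^^ i) (q j) = \<zero>"
      using arm that p q
      \<comment> \<open>The Armendariz property is phrased with \<open>coeff\<close>, which is plain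
        application on \<open>up R\<close>; the second pass unfolds it.\<close>
      by (auto simp: skew_Armendariz_def carrier_skew_UP)
        (auto simp: skew_UP_def UP_def)
    then show "p i \<otimes> q j = \<zero>"
      by (simp add: swap)
  qed
  show ?prod if ?coeffs
  proof -
    have "p i \<otimes> (\<alpha> ^^ i) (q j) = \<zero>" for i j
      using that by (simp add: swap)
    then show ?thesis
      using p q by (simp add: skew_UP_mult skew_UP_ops) (simp add: UP_def)
  qed
qed

lemma const_skew_UP:
  assumes "c \<in> carrier R"
  shows "(\<lambda>i. if i = 0 then c else \<zero>) \<in> up R"
  using assms by (intro mem_upI exI[of _ 0] bound.intro) auto

text \<open>Only the summand with i = 0 survives, and there the twist is the identity, so a constant
  on the left acts as an untwisted scalar.\<close>

lemma const_mult_skew_UP: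
  assumes c: "c \<in> carrier R" and q: "q \<in> up R" and h: "\<alpha> \<in> ring_hom R R"
  shows "(\<lambda>i. if i = 0 then c else \<zero>) \<otimes>\<^bsub>skew_UP R \<alpha>\<^esub> q = (\<lambda>n. c \<otimes> q n)"
proof -
  have qc: "q i \<in> carrier R" for i
    using q by auto
  have "(\<Oplus>i \<in> {..n}. (if i = 0 then c else \<zero>) \<otimes> (\<alpha> ^^ i) (q (n - i))) = c \<otimes> q n" for n
  proof -
    have "(\<Oplus>i \<in> {..n}. (if i = 0 then c else \<zero>) \<otimes> (\<alpha> ^^ i) (q (n - i)))
        = (\<Oplus>i \<in> {..n}. if 0 = i then c \<otimes> q (n - i) else \<zero>)"
      using ring_hom_closed[OF funpow_ring_hom[OF h]] by (intro finsum_cong') (auto simp: c qc)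
    also have "\<dots> = c \<otimes> q n"
      using finsum_singleton[of 0 "{..n}" "\<lambda>i. c \<otimes> q (n - i)"] c qc by simp
    finally show ?thesis .
  qed
  then show ?thesis
    using q const_skew_UP[OF c] by (simp add: skew_UP_mult)
qed

text \<open>Powers of constants stay constant, so a nilpotent element of \<open>R\<close> yields a
  nilpotent constant polynomial.\<close>

lemma const_pow_skew_UP:
  fixes n :: nat
  assumes c: "c \<in> carrier R" and h: "\<alpha> \<in> ring_hom R R"
  shows "(\<lambda>i. if i = 0 then c else \<zero>) [^]\<^bsub>skew_UP R \<alpha>\<^esub> n
    = (\<lambda>i. if i = 0 then c [^] n else \<zero>)"
proof (induction n)
  case 0
  then show ?case by (auto simp: skew_UP_ops UP_def)
next
  case (Suc n)
  interpret S: ring "skew_UP R \<alpha>" using skew_UP_ring[OF h] .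
  have "(\<lambda>i. if i = 0 then c else \<zero>) [^]\<^bsub>skew_UP R \<alpha>\<^esub> Suc n
      = (\<lambda>i. if i = 0 then c else \<zero>) \<otimes>\<^bsub>skew_UP R \<alpha>\<^esub> (\<lambda>i. if i = 0 then c [^] n else \<zero>)"
    using S.nat_pow_Suc2[of "\<lambda>i. if i = 0 then c else \<zero>" n] const_skew_UP[OF c] Suc
    by (simp add: carrier_skew_UP)
  also have "\<dots> = (\<lambda>i. if i = 0 then c [^] Suc n else \<zero>)"
    using c const_mult_skew_UP[OF c const_skew_UP h, of "c [^] n"] nat_pow_Suc2[OF c, of n] by auto
  finally show ?case .
qed

text \<open>Induction on the exponent: one factor f is moved from the power into the left
  polynomial. Replacing g by the constant \<open>g i\<close> first makes the j-th coefficient of the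
  new left polynomial exactly \<open>g i \<otimes> f j\<close>, whereas the coefficients of g f
  would be sums of twisted products.\<close>

lemma skew_UP_mult_pow_eq_zero:
  fixes n :: nat
  assumes h: "\<alpha> \<in> ring_hom R R" and cond: "alpha_condition R \<alpha>"
    and arm: "skew_Armendariz R \<alpha>" and f: "f \<in> up R"
  shows "g \<in> up R \<Longrightarrow> g \<otimes>\<^bsub>skew_UP R \<alpha>\<^esub> f [^]\<^bsub>skew_UP R \<alpha>\<^esub> n = \<zero>\<^bsub>skew_UP R \<alpha>\<^esub>
    \<Longrightarrow> g i \<otimes> f j [^] n = \<zero>"
proof (induction n arbitrary: g i)
  case 0
  interpret S: ring "skew_UP R \<alpha>" using skew_UP_ring[OF h] .
  have "g = \<zero>\<^bsub>skew_UP R \<alpha>\<^esub>"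
    using 0 by (simp add: carrier_skew_UP)
  then have "g i = \<zero>"
    unfolding skew_UP_ops by (simp add: UP_def)
  then show ?case by simp
next
  case (Suc n)
  interpret S: ring "skew_UP R \<alpha>" using skew_UP_ring[OF h] .
  note gc = mem_upD[OF Suc.prems(1), of i] and fc = mem_upD[OF f, of j]
  let ?c = "\<lambda>k. if k = 0 then g i else \<zero>"
  have fS: "f \<in> carrier (skew_UP R \<alpha>)"
    using f by (simp add: carrier_skew_UP)
  have pow: "f [^]\<^bsub>skew_UP R \<alpha>\<^esub> Suc n \<in> up R"
    using S.nat_pow_closed[OF fS] unfolding carrier_skew_UP .
  note pow_c = mem_upD[OF pow]
  have c: "?c \<in> up R"
    using const_skew_UP[OF gc] .
  then have cS: "?c \<in> carrier (skew_UP R \<alpha>)"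
    by (simp add: carrier_skew_UP)
  have "\<forall>k l. g k \<otimes> (f [^]\<^bsub>skew_UP R \<alpha>\<^esub> Suc n) l = \<zero>"
    using Suc.prems(2) unfolding skew_UP_mult_eq_zero_iff[OF h cond arm Suc.prems(1) pow] .
  \<comment> \<open>Each coefficient of \<open>?c\<close> is \<open>g i\<close> or zero, so the
    zero-product criterion read backwards applies to it.\<close>
  then have "?c \<otimes>\<^bsub>skew_UP R \<alpha>\<^esub> f [^]\<^bsub>skew_UP R \<alpha>\<^esub> Suc n = \<zero>\<^bsub>skew_UP R \<alpha>\<^esub>"
    unfolding skew_UP_mult_eq_zero_iff[OF h cond arm c pow]
    by (simp only: l_null[OF pow_c] split: if_split) blast
  then have "?c \<otimes>\<^bsub>skew_UP R \<alpha>\<^esub> f \<otimes>\<^bsub>skew_UP R \<alpha>\<^esub> f [^]\<^bsub>skew_UP R \<alpha>\<^esub> n = \<zero>\<^bsub>skew_UP R \<alpha>\<^esub>"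
    by (simp only: S.nat_pow_Suc2[OF fS] S.m_assoc[OF cS fS S.nat_pow_closed[OF fS]])
  moreover have "?c \<otimes>\<^bsub>skew_UP R \<alpha>\<^esub> f \<in> up R"
    using S.m_closed[OF cS fS] by (simp only: carrier_skew_UP)
  \<comment> \<open>The induction hypothesis is used with the left polynomial \<open>?c\<close>
    times f, which is why g is kept arbitrary, and with the index of its coefficient chosen equal to
    j.\<close>
  ultimately have "(?c \<otimes>\<^bsub>skew_UP R \<alpha>\<^esub> f) j \<otimes> f j [^] n = \<zero>"
    by (intro Suc.IH)
  then have "g i \<otimes> f j \<otimes> f j [^] n = \<zero>"
    by (simp only: const_mult_skew_UP[OF gc f h])
  then show ?case
    using nat_pow_Suc2[OF fc, of n] gc fc by (simp add: m_assoc)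
qed

text \<open>Taking g = 1 in the preceding lemma and reading off its coefficient 1 at index 0 gives
  \<open>f j [^] n = \<zero>\<close>, with the same exponent n for every j.\<close>

lemma nilpotents_skew_UP_coeff:
  assumes h: "\<alpha> \<in> ring_hom R R" and cond: "alpha_condition R \<alpha>"
    and arm: "skew_Armendariz R \<alpha>" and f: "f \<in> nilpotents (skew_UP R \<alpha>)"
  shows "f j \<in> nilpotents R"
proof -
  interpret S: ring "skew_UP R \<alpha>" using skew_UP_ring[OF h] .
  from f obtain n :: nat where n: "n \<ge> 1" "f [^]\<^bsub>skew_UP R \<alpha>\<^esub> n = \<zero>\<^bsub>skew_UP R \<alpha>\<^esub>" and fu: "f \<in> up R"
    by (auto simp: nilpotents_def carrier_skew_UP)
  have one: "\<one>\<^bsub>skew_UP R \<alpha>\<^esub> \<in> up R"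
    using S.one_closed by (simp only: carrier_skew_UP)
  have fc: "f j \<in> carrier R"
    using fu by auto
  have "\<one>\<^bsub>skew_UP R \<alpha>\<^esub> 0 \<otimes> f j [^] n = \<zero>"
    using skew_UP_mult_pow_eq_zero[OF h cond arm fu one, of n 0 j] n by simp
  moreover have "\<one>\<^bsub>skew_UP R \<alpha>\<^esub> 0 = \<one>"
    by (simp add: skew_UP_ops) (simp add: UP_def)
  ultimately show ?thesis
    using n fc by (auto simp: nilpotents_def)
qed

lemma LNZS_skew_UP_iff:
  assumes h: "\<alpha> \<in> ring_hom R R" and cond: "alpha_condition R \<alpha>"
    and arm: "skew_Armendariz R \<alpha>"
  shows "LNZS R \<longleftrightarrow> LNZS (skew_UP R \<alpha>)"
proof -
  interpret S: ring "skew_UP R \<alpha>" using skew_UP_ring[OF h] .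
  note zero_iff = skew_UP_mult_eq_zero_iff[OF h cond arm]
  show ?thesis
  proof
    assume R: "LNZS R"
    show "LNZS (skew_UP R \<alpha>)"
      unfolding S.LNZS_iff
    proof (intro ballI impI)
      fix f g r
      assume f: "f \<in> nilpotents (skew_UP R \<alpha>)" and gS: "g \<in> carrier (skew_UP R \<alpha>)"
        and rS: "r \<in> carrier (skew_UP R \<alpha>)"
        and gf: "g \<otimes>\<^bsub>skew_UP R \<alpha>\<^esub> f = \<zero>\<^bsub>skew_UP R \<alpha>\<^esub>"
      have fu: "f \<in> up R" and gu: "g \<in> up R" and ru: "r \<in> up R"
        using f gS rS by (auto simp: nilpotents_def carrier_skew_UP)
      have c: "f i \<in> carrier R" "g i \<in> carrier R" "(\<alpha> ^^ k) (r i) \<in> carrier R" for i k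
        using fu gu ring_hom_closed[OF funpow_ring_hom[OF h] mem_upD[OF ru]] by auto
      \<comment> \<open>The criterion gives \<open>g i \<otimes> f j = \<zero>\<close> with
        \<open>f j\<close> nilpotent, so LNZS of \<open>R\<close> allows any ring element in
        between. The element chosen is the twisted coefficient that occurs in the product of g and
        r.\<close>
      have "g i \<otimes> (\<alpha> ^^ i) (r k) \<otimes> f j = \<zero>" for i j k
        using R c nilpotents_skew_UP_coeff[OF h cond arm f] gf zero_iff[OF gu fu]
        by (auto simp: LNZS_iff)
      \<comment> \<open>The n-th coefficient of the product of g and r is a sum of the terms just
        treated, with k = n - i; distributing \<open>f j\<close> over it leaves only zeros.\<close>
      then have "(g \<otimes>\<^bsub>skew_UP R \<alpha>\<^esub> r) n \<otimes> f j = \<zero>" for n j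
        by (simp add: skew_UP_mult gu ru c finsum_ldistr)
      then show "g \<otimes>\<^bsub>skew_UP R \<alpha>\<^esub> r \<otimes>\<^bsub>skew_UP R \<alpha>\<^esub> f = \<zero>\<^bsub>skew_UP R \<alpha>\<^esub>"
        using zero_iff[OF _ fu] S.m_closed[OF gS rS] by (simp add: carrier_skew_UP)
    qed
  next
    assume S: "LNZS (skew_UP R \<alpha>)"
    \<comment> \<open>The embedding of \<open>R\<close> as constant polynomials: \<open>Cm\<close>
      shows that it preserves products, and \<open>C0\<close> that it reflects zero.\<close>
    define C where "C a = (\<lambda>i::nat. if i = 0 then a else \<zero>)" for a
    have Cu: "C a \<in> carrier (skew_UP R \<alpha>)" if "a \<in> carrier R" for a
      using const_skew_UP[OF that] by (simp add: C_def carrier_skew_UP)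
    have Cm: "C a \<otimes>\<^bsub>skew_UP R \<alpha>\<^esub> C b = C (a \<otimes> b)" if "a \<in> carrier R" "b \<in> carrier R" for a b
      using that const_mult_skew_UP[OF _ const_skew_UP h, of a b] by (auto simp: C_def)
    have C0: "C a = \<zero>\<^bsub>skew_UP R \<alpha>\<^esub> \<longleftrightarrow> a = \<zero>" for a
      by (auto simp: skew_UP_ops UP_def C_def fun_eq_iff)
    show "LNZS R"
      unfolding LNZS_iff
    proof (intro ballI impI)
      fix a y r
      assume a: "a \<in> nilpotents R" and y: "y \<in> carrier R" and r: "r \<in> carrier R"
        and ya: "y \<otimes> a = \<zero>"
      from a obtain n :: nat where n: "n \<ge> 1" "a [^] n = \<zero>" and ac: "a \<in> carrier R"
        by (auto simp: nilpotents_def)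
      have "C a [^]\<^bsub>skew_UP R \<alpha>\<^esub> n = \<zero>\<^bsub>skew_UP R \<alpha>\<^esub>"
        using C0[of "a [^] n"] n(2) unfolding C_def const_pow_skew_UP[OF ac h] by blast
      then have "C a \<in> nilpotents (skew_UP R \<alpha>)"
        using n Cu[OF ac] by (auto simp: nilpotents_def)
      moreover have "C y \<otimes>\<^bsub>skew_UP R \<alpha>\<^esub> C a = \<zero>\<^bsub>skew_UP R \<alpha>\<^esub>"
        using Cm[OF y ac] C0 ya by simp
      \<comment> \<open>LNZS of the skew polynomial ring is applied at the nilpotent constant
        \<open>C a\<close>; the resulting product is \<open>C (y \<otimes> r \<otimes> a)\<close>,
        so its vanishing descends to \<open>R\<close>.\<close>
      ultimately have "C y \<otimes>\<^bsub>skew_UP R \<alpha>\<^esub> C r \<otimes>\<^bsub>skew_UP R \<alpha>\<^esub> C a = \<zero>\<^bsub>skew_UP R \<alpha>\<^esub>"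
        using S Cu[OF y] Cu[OF r] unfolding S.LNZS_iff by blast
      then show "y \<otimes> r \<otimes> a = \<zero>"
        using y r ac by (simp add: Cm C0)
    qed
  qed
qed

end

theorem theorem2p28:
  fixes R :: "('a, 'm) ring_scheme" and \<alpha> :: "'a \<Rightarrow> 'a"
  assumes "ring R"
    and "\<alpha> \<in> ring_hom R R"
    and "alpha_condition R \<alpha>"
    and "skew_Armendariz R \<alpha>"
  shows "LNZS R \<longleftrightarrow> LNZS (skew_UP R \<alpha>)"
  using ring.LNZS_skew_UP_iff[OF assms] .

end
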